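(* Let $N$ be a positive integer which is not a perfect square and let $q$ be a positive integer dividing $N$ with $N>q^2$; put $\alpha=\frac{\sqrt N}{q}$ (that is, $p=0$). Let $[a_0,a_1,a_2,\dots]$ be the continued fraction expansion of $\alpha$ with sequence of complete quotients $(\zeta_n)_{n\ge0}$, and let $(y_n)_{n\ge0}$ and $(t_n)_{n\ge0}$ be the sequences of direction-change values and of step counts of the left-positive path (LPP) of $\alpha$. Then, for every non-negative integer $n$: - $\zeta_n=-y_n^*$ if $n$ is even and $\zeta_n=-\frac{1}{y_n^*}$ if $n$ is odd; - $a_n=t_n$.
   Context: General setting: $N$ is a positive integer which is not a perfect square, $p$ is an integer with $p^2<N$, $q$ is a positive integer dividing $N-p^2$, and $\alpha=\frac{\sqrt N+p}{q}$ (here $p=0$). The Calkin-Wilf tree of $\alpha$ is the infinite binary tree whose root is labeled $\alpha$ and in which every vertex labeled $x$ has a left child labeled $\frac{x}{x+1}$ and a right child labeled $x+1$ (since $\alpha>0$, all labels are positive). Each vertex carries a triple $(\varepsilon,c,d)$ with $\varepsilon\in\{-1,1\}$, $c$ an integer, $d$ a positive integer dividing $N-c^2$, and label equal to $\frac{\varepsilon\sqrt N+c}{d}$, defined as follows. The root has triple $(1,p,q)$. If a vertex has triple $(\varepsilon,c,d)$, its right child has triple $(\varepsilon,c+d,d)$; its left child has triple $\left(-\varepsilon,\frac{N-c^2}{d}-c,\frac{N-(c+d)^2}{d}\right)$ if $N-(c+d)^2>0$, and $\left(\varepsilon,c-\frac{N-c^2}{d},\frac{(c+d)^2-N}{d}\right)$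 otherwise. The left-positive path (LPP) of $\alpha$ is the infinite descending path which starts at the root and which, from each vertex, goes to the left child if the value of $\varepsilon$ for that left child is $1$, and to the right child otherwise. $x_n$ denotes the label of the $n$-th vertex of the LPP, with $x_0=\alpha$. Put $s_n=\ell$ if the step from $x_n$ to $x_{n+1}$ goes to the left child, and $s_n=r$ if it goes to the right child. Direction changes: put $\varphi(0)=0$ and, for $n\ge0$, let $\varphi(n+1)$ be the least integer $k>\varphi(n)$ with $s_{k-1}\ne s_k$ (such $k$ always exists). Put $y_n=x_{\varphi(n)}$ and $t_n=\varphi(n+1)-\varphi(n)$. For rational numbers $a,b$, the algebraic conjugate of $x=a\sqrt N+b$ is $x^*=-a\sqrt N+b$. The (regular) continued fraction expansion of $\alpha$ is defined by $\zeta_0=\alpha$, $a_0=\lfloor\zeta_0\rfloor$ and, for every integer $n\ge0$, $\zeta_{n+1}=\frac{1}{\zeta_n-a_n}$, $a_{n+1}=\lfloor\zeta_{n+1}\rfloor$; the $\zeta_n$ are the complete quotients. *)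

theory Defs
  imports Complex_Main
begin

datatype dir = Lt | Rt

text \<open>A vertex of the infinite binary tree is the list of steps leading to it from the root,
  the most recent step first; the root is the empty list.\<close>

type_synonym vertex = "dir list"

primrec cw_label :: "real \<Rightarrow> vertex \<Rightarrow> real" where
  "cw_label \<alpha> [] = \<alpha>"
| "cw_label \<alpha> (s # v) =
    (case s of Lt \<Rightarrow> cw_label \<alpha> v / (cw_label \<alpha> v + 1) | Rt \<Rightarrow> cw_label \<alpha> v + 1)"

text \<open>The triple \<open>(\<epsilon>, c, d)\<close> stands for the number \<open>(\<epsilon> \<surd>N + c) / d\<close>. All integer divisions
  below are exact along the tree, and the triples represent the labels: see the lemmas
  \<open>cw_triple_invariant\<close> and \<open>cw_label_eq_triple\<close>.\<close>

type_synonym triple = "int \<times> int \<times> int"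

fun child_triple :: "int \<Rightarrow> dir \<Rightarrow> triple \<Rightarrow> triple" where
  "child_triple N Rt (\<epsilon>, c, d) = (\<epsilon>, c + d, d)"
| "child_triple N Lt (\<epsilon>, c, d) =
    (if N - (c + d)\<^sup>2 > 0
     then (- \<epsilon>, (N - c\<^sup>2) div d - c, (N - (c + d)\<^sup>2) div d)
     else (\<epsilon>, c - (N - c\<^sup>2) div d, ((c + d)\<^sup>2 - N) div d))"

primrec cw_triple :: "int \<Rightarrow> int \<Rightarrow> int \<Rightarrow> vertex \<Rightarrow> triple" where
  "cw_triple N p q [] = (1, p, q)"
| "cw_triple N p q (s # v) = child_triple N s (cw_triple N p q v)"

definition lpp_next :: "int \<Rightarrow> int \<Rightarrow> int \<Rightarrow> vertex \<Rightarrow> dir" where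
  "lpp_next N p q v = (if fst (cw_triple N p q (Lt # v)) = 1 then Lt else Rt)"

primrec lpp :: "int \<Rightarrow> int \<Rightarrow> int \<Rightarrow> nat \<Rightarrow> vertex" where
  "lpp N p q 0 = []"
| "lpp N p q (Suc n) = lpp_next N p q (lpp N p q n) # lpp N p q n"

definition lpp_x :: "int \<Rightarrow> int \<Rightarrow> int \<Rightarrow> nat \<Rightarrow> real" where
  "lpp_x N p q n = cw_label ((sqrt N + p) / q) (lpp N p q n)"

definition lpp_s :: "int \<Rightarrow> int \<Rightarrow> int \<Rightarrow> nat \<Rightarrow> dir" where
  "lpp_s N p q n = lpp_next N p q (lpp N p q n)"

text \<open>Under the standing assumptions both directions occur infinitely often along the path, so
  the minimum exists.\<close>

primrec lpp_phi :: "int \<Rightarrow> int \<Rightarrow> int \<Rightarrow> nat \<Rightarrow> nat" where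
  "lpp_phi N p q 0 = 0"
| "lpp_phi N p q (Suc n) =
    (LEAST k. k > lpp_phi N p q n \<and> lpp_s N p q (k - 1) \<noteq> lpp_s N p q k)"

definition lpp_y :: "int \<Rightarrow> int \<Rightarrow> int \<Rightarrow> nat \<Rightarrow> real" where
  "lpp_y N p q n = lpp_x N p q (lpp_phi N p q n)"

definition lpp_t :: "int \<Rightarrow> int \<Rightarrow> int \<Rightarrow> nat \<Rightarrow> int" where
  "lpp_t N p q n = int (lpp_phi N p q (Suc n)) - int (lpp_phi N p q n)"

text \<open>Meaningful only when \<open>N\<close> is a positive non-square and \<open>x\<close> lies in \<open>\<rat>(\<surd>N)\<close>: then
  the representation of \<open>x\<close>, hence the conjugate, is unique (lemma \<open>qconj_eq\<close>).\<close>

definition qconj :: "int \<Rightarrow> real \<Rightarrow> real" where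
  "qconj N x = (THE y. \<exists>a\<in>\<rat>. \<exists>b\<in>\<rat>. x = a * sqrt N + b \<and> y = - a * sqrt N + b)"

primrec cf_quot :: "real \<Rightarrow> nat \<Rightarrow> real" where
  "cf_quot \<alpha> 0 = \<alpha>"
| "cf_quot \<alpha> (Suc n) = 1 / (cf_quot \<alpha> n - \<lfloor>cf_quot \<alpha> n\<rfloor>)"

definition cf_coeff :: "real \<Rightarrow> nat \<Rightarrow> int" where
  "cf_coeff \<alpha> n = \<lfloor>cf_quot \<alpha> n\<rfloor>"

lemma sqrt_nonsquare_irrational:
  fixes N :: int
  assumes "N > 0" "\<nexists>k. N = k\<^sup>2"
  shows "sqrt N \<notin> \<rat>"
proof
  assume "sqrt N \<in> \<rat>"
  then obtain m n :: nat where n: "n \<noteq> 0" and e: "\<bar>sqrt N\<bar> = m / n"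
    by (rule Rats_abs_nat_div_natE)
  have "real_of_int N = (m / n)\<^sup>2"
    using e assms(1) by (metis abs_ge_zero abs_of_nonneg of_int_0_le_iff order_less_imp_le
        real_sqrt_ge_zero real_sqrt_pow2)
  then have "real_of_int (N * (int n)\<^sup>2) = real_of_int ((int m)\<^sup>2)"
    using n by (simp add: field_simps power_divide)
  then have eq: "N * (int n)\<^sup>2 = (int m)\<^sup>2"
    by (simp only: of_int_eq_iff)
  then have "(int n)\<^sup>2 dvd (int m)\<^sup>2"
    by (metis dvd_triv_right)
  then have "int n dvd int m"
    by simp
  then obtain k where "int m = int n * k" ..
  then have "N = k\<^sup>2"
    using eq n by (simp add: power_mult_distrib)
  then show False
    using assms(2) by blast
qed

lemma qconj_eq:
  assumes N: "N > 0" "\<nexists>k. N = k\<^sup>2" and ab: "a \<in> \<rat>" "b \<in> \<rat>"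
  shows "qconj N (a * sqrt N + b) = - a * sqrt N + b"
  unfolding qconj_def
proof (rule the_equality)
  show "\<exists>a'\<in>\<rat>. \<exists>b'\<in>\<rat>. a * sqrt N + b = a' * sqrt N + b'
      \<and> - a * sqrt N + b = - a' * sqrt N + b'"
    using ab by blast
next
  fix y
  assume "\<exists>a'\<in>\<rat>. \<exists>b'\<in>\<rat>. a * sqrt N + b = a' * sqrt N + b' \<and> y = - a' * sqrt N + b'"
  then obtain a' b' where r: "a' \<in> \<rat>" "b' \<in> \<rat>" and
    e: "a * sqrt N + b = a' * sqrt N + b'" and y: "y = - a' * sqrt N + b'"
    by blast
  have "a = a'"
  proof (rule ccontr)
    assume "a \<noteq> a'"
    then have "sqrt N = (b' - b) / (a - a')"
      using e by (simp add: field_simps)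
    then have "sqrt N \<in> \<rat>"
      using r ab by simp
    then show False
      using sqrt_nonsquare_irrational[OF N] by blast
  qed
  then show "y = - a * sqrt N + b"
    using e y by simp
qed

lemma child_triple_correct:
  fixes N \<epsilon> c d :: int
  assumes N: "N > 0" "\<nexists>k. N = k\<^sup>2"
    and inv: "\<epsilon> \<in> {-1, 1}" "d > 0" "d dvd N - c\<^sup>2"
    and t: "child_triple N s (\<epsilon>, c, d) = (\<epsilon>', c', d')"
  shows "\<epsilon>' \<in> {-1, 1} \<and> d' > 0 \<and> d' dvd N - c'\<^sup>2"
    and "(\<epsilon>' * sqrt N + c') / d' =
      (let x = (\<epsilon> * sqrt N + c) / d in case s of Lt \<Rightarrow> x / (x + 1) | Rt \<Rightarrow> x + 1)"
proof -
  obtain m where m: "N - c\<^sup>2 = d * m"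
    using inv(3) ..
  have e2: "\<epsilon> * \<epsilon> = 1"
    using inv(1) by auto
  define w where "w = m - 2 * c - d"
  have w: "N - (c + d)\<^sup>2 = d * w"
    using m by (simp add: w_def power2_eq_square algebra_simps)
  then have w': "(c + d)\<^sup>2 - N = d * (- w)"
    by (simp add: algebra_simps)
  have "w \<noteq> 0"
    using w N(2) by auto
  have pos: "N - (c + d)\<^sup>2 > 0 \<longleftrightarrow> w > 0"
    unfolding w using inv(2) by (simp add: zero_less_mult_iff)
  have child: "(\<epsilon>', c', d') = (case s of Rt \<Rightarrow> (\<epsilon>, c + d, d)
      | Lt \<Rightarrow> if w > 0 then (- \<epsilon>, m - c, w) else (\<epsilon>, c - m, - w))"
  proof (cases s)
    case Lt
    have q: "(N - c\<^sup>2) div d = m" "(N - (c + d)\<^sup>2) div d = w" "((c + d)\<^sup>2 - N) div d = - w"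
      unfolding m w w' using inv(2) by (simp_all only: nonzero_mult_div_cancel_left less_imp_neq[symmetric] simp_thms)
    show ?thesis
      using t unfolding Lt child_triple.simps pos q by simp
  next
    case Rt
    then show ?thesis using t by simp
  qed
  have id: "N - (m - c)\<^sup>2 = w * (- m)"
    using m by (simp add: w_def power2_eq_square algebra_simps)
  have dw: "w dvd N - (m - c)\<^sup>2"
    unfolding id by simp
  have cm: "(c - m)\<^sup>2 = (m - c)\<^sup>2"
    by (simp add: power2_commute)
  have dr: "d dvd N - (c + d)\<^sup>2"
    unfolding w by simp
  show "\<epsilon>' \<in> {-1, 1} \<and> d' > 0 \<and> d' dvd N - c'\<^sup>2"
    using child inv dw dr \<open>w \<noteq> 0\<close> by (cases s) (auto simp: cm split: if_splits)
  define S where "S = sqrt N"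
  have S2: "S * S = N"
    using N(1) by (simp add: S_def)
  have irr: "\<epsilon> * S + c + d \<noteq> 0"
  proof
    assume "\<epsilon> * S + c + d = 0"
    then have "S = - \<epsilon> * (c + d)"
      using inv(1) by auto
    then have "S \<in> \<rat>"
      by simp
    then show False
      using sqrt_nonsquare_irrational[OF N] by (simp add: S_def)
  qed
  have dn: "real_of_int d \<noteq> 0" "real_of_int w \<noteq> 0"
    using inv(2) \<open>w \<noteq> 0\<close> by auto
  have mR: "S * S = c * c + d * real_of_int m"
    unfolding S2 using arg_cong[OF m, of real_of_int] by (simp add: power2_eq_square)
  have wR: "real_of_int w = m - 2 * c - d"
    by (simp add: w_def)
  have e2R: "real_of_int \<epsilon> * \<epsilon> = 1"
    using arg_cong[OF e2, of real_of_int] by simp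
  have x1: "(\<epsilon> * S + c) / d + 1 = (\<epsilon> * S + c + d) / d"
    using dn by (simp add: field_simps)
  have "(\<epsilon> * S + c) / d / ((\<epsilon> * S + c) / d + 1) = (\<epsilon> * S + c) / (\<epsilon> * S + c + d)"
    unfolding x1 using dn by simp
  also have "\<dots> = (- \<epsilon> * S + m - c) / w"
  proof -
    have "(- \<epsilon> * S + m - c) * (\<epsilon> * S + c + d)
      = - (\<epsilon> * \<epsilon>) * (S * S) + \<epsilon> * S * (m - 2 * c - d) + (m - c) * (c + d)"
      by (simp add: algebra_simps)
    also have "\<dots> = - (S * S) + \<epsilon> * S * (m - 2 * c - d) + (m - c) * (c + d)"
      using e2R by simp
    also have "\<dots> = (\<epsilon> * S + c) * w"
      unfolding mR wR by (simp add: algebra_simps)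
    finally show ?thesis
      using irr dn by (simp add: frac_eq_eq)
  qed
  finally have left: "(\<epsilon> * S + c) / d / ((\<epsilon> * S + c) / d + 1) = (- \<epsilon> * S + m - c) / w" .
  have neg: "(\<epsilon> * S + (c - m)) / (- w) = (- \<epsilon> * S + m - c) / w"
    using dn by (simp add: field_simps)
  show "(\<epsilon>' * sqrt N + c') / d' =
      (let x = (\<epsilon> * sqrt N + c) / d in case s of Lt \<Rightarrow> x / (x + 1) | Rt \<Rightarrow> x + 1)"
  proof (cases s)
    case Lt
    show ?thesis
    proof (cases "w > 0")
      case True
      then have "\<epsilon>' = - \<epsilon>" "c' = m - c" "d' = w"
        using child Lt by auto
      then show ?thesis
        using Lt left by (simp add: add_diff_eq S_def)
    next
      case False
      then have "\<epsilon>' = \<epsilon>" "c' = c - m" "d' = - w"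
        using child Lt by auto
      then show ?thesis
        using Lt left neg by (simp only: dir.case of_int_minus of_int_diff Let_def S_def)
    qed
  next
    case Rt
    then show ?thesis
      using child x1 by (simp add: add.assoc S_def)
  qed
qed

lemma cw_triple_invariant:
  assumes "N > 0" "\<nexists>k. N = k\<^sup>2" "q > 0" "q dvd N - p\<^sup>2"
    and "cw_triple N p q v = (\<epsilon>, c, d)"
  shows "\<epsilon> \<in> {-1, 1} \<and> d > 0 \<and> d dvd N - c\<^sup>2"
  using assms(5)
proof (induction v arbitrary: \<epsilon> c d)
  case Nil
  then show ?case using assms by auto
next
  case (Cons s v)
  obtain e0 c0 d0 where *: "cw_triple N p q v = (e0, c0, d0)"
    by (cases "cw_triple N p q v")
  show ?case
    using child_triple_correct(1)[OF assms(1,2), of e0 d0 c0 s \<epsilon> c d] Cons.IH[OF *]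
      Cons.prems * by simp
qed

lemma cw_label_eq_triple:
  assumes "N > 0" "\<nexists>k. N = k\<^sup>2" "q > 0" "q dvd N - p\<^sup>2"
    and "cw_triple N p q v = (\<epsilon>, c, d)"
  shows "cw_label ((sqrt N + p) / q) v = (\<epsilon> * sqrt N + c) / d"
  using assms(5)
proof (induction v arbitrary: \<epsilon> c d)
  case Nil
  then show ?case by auto
next
  case (Cons s v)
  obtain e0 c0 d0 where *: "cw_triple N p q v = (e0, c0, d0)"
    by (cases "cw_triple N p q v")
  have i: "e0 \<in> {-1, 1}" "d0 > 0" "d0 dvd N - c0\<^sup>2"
    using cw_triple_invariant[OF assms(1-4) *] by auto
  have "child_triple N s (e0, c0, d0) = (\<epsilon>, c, d)"
    using Cons.prems * by simp
  from child_triple_correct(2)[OF assms(1,2) i this] show ?case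
    using Cons.IH[OF *] by (cases s) (simp_all add: Let_def)
qed

end

theory Submission imports Defs begin

text \<open>Put \<open>z\<^sub>k = - x\<^sub>k\<^sup>*\<close>. Conjugation commutes with the two child maps, so a right step sends
  \<open>z\<close> to \<open>z - 1\<close> and a left step sends \<open>1 / z\<close> to \<open>1 / z - 1\<close>; and the path turns left exactly when
  \<open>z < 1\<close>. Hence the path runs the subtractive (slow) continued fraction algorithm on
  \<open>z\<^sub>0 = \<alpha>\<close>: the direction changes when the current complete quotient has been reduced to its
  fractional part.\<close>

section \<open>Conjugation on triples and labels\<close>

text \<open>Neither the case test nor the new \<open>c\<close> and \<open>d\<close> involve
  \<epsilon>, so flipping its sign, which is conjugation on triples, commutes with passing to a
  child.\<close>

lemma child_triple_uminus:
  assumes "child_triple N s (\<epsilon>, c, d) = (\<epsilon>', c', d')"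
  shows "child_triple N s (- \<epsilon>, c, d) = (- \<epsilon>', c', d')"
  using assms by (cases s) (auto split: if_splits)

lemma qconj_triple:
  fixes N \<epsilon> c d :: int
  assumes "N > 0" "\<nexists>k. N = k\<^sup>2"
  shows "qconj N ((\<epsilon> * sqrt N + c) / d) = (- \<epsilon> * sqrt N + c) / d"
  using qconj_eq[OF assms, of "\<epsilon> / d" "c / d"] by (simp add: add_divide_distrib diff_divide_distrib)

lemma qconj_cw_label_Cons:
  assumes N: "N > 0" "\<nexists>k. N = k\<^sup>2" and q: "q > 0" "q dvd N - p\<^sup>2"
  shows "qconj N (cw_label ((sqrt N + p) / q) (s # v)) =
    (let y = qconj N (cw_label ((sqrt N + p) / q) v)
     in case s of Lt \<Rightarrow> y / (y + 1) | Rt \<Rightarrow> y + 1)"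
proof -
  obtain \<epsilon> c d where t: "cw_triple N p q v = (\<epsilon>, c, d)"
    by (cases "cw_triple N p q v")
  obtain \<epsilon>' c' d' where t': "cw_triple N p q (s # v) = (\<epsilon>', c', d')"
    by (cases "cw_triple N p q (s # v)")
  have "child_triple N s (- \<epsilon>, c, d) = (- \<epsilon>', c', d')"
    using t t' by (intro child_triple_uminus) simp
  \<comment> \<open>The invariant is symmetric in the sign of \<epsilon>, so
    \<open>child_triple_correct\<close> applies to the conjugate triple as well.\<close>
  moreover have "- \<epsilon> \<in> {-1, 1}" "d > 0" "d dvd N - c\<^sup>2"
    using cw_triple_invariant[OF N q t] by auto
  ultimately have "(- \<epsilon>' * sqrt N + c') / d' =
      (let y = (- \<epsilon> * sqrt N + c) / d in case s of Lt \<Rightarrow> y / (y + 1) | Rt \<Rightarrow> y + 1)"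
    using child_triple_correct(2)[OF N, of "- \<epsilon>" d c s "- \<epsilon>'" c' d'] by simp
  then show ?thesis
    unfolding cw_label_eq_triple[OF N q t] cw_label_eq_triple[OF N q t']
    by (simp only: qconj_triple[OF N])
qed

section \<open>The negated conjugates along the path\<close>

lemma cw_label_pos: "\<alpha> > 0 \<Longrightarrow> cw_label \<alpha> v > 0"
  by (induction v) (auto split: dir.split intro: add_pos_pos divide_pos_pos)

text \<open>Right steps keep \<epsilon>, and a left step is taken only when it leads to \<epsilon> =
  1.\<close>

lemma fst_cw_triple_lpp: "fst (cw_triple N p q (lpp N p q n)) = 1"
proof (induction n)
  case (Suc n)
  then show ?case
    by (cases "cw_triple N p q (lpp N p q n)") (auto simp: lpp_next_def)
qed simp

definition lpp_z :: "int \<Rightarrow> int \<Rightarrow> int \<Rightarrow> nat \<Rightarrow> real" where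
  "lpp_z N p q n = - qconj N (lpp_x N p q n)"

context
  fixes N p q :: int
  assumes N: "N > 0" "\<nexists>k::int. N = k\<^sup>2"
    and pq: "p\<^sup>2 < N" "q > 0" "q dvd N - p\<^sup>2"
begin

lemma root_pos: "(sqrt N + p) / q > 0"
proof -
  have "sqrt (real_of_int (p\<^sup>2)) < sqrt N"
    using pq(1) by (intro real_sqrt_less_mono) (simp only: of_int_less_iff)
  then have "\<bar>real_of_int p\<bar> < sqrt N"
    by simp
  then show ?thesis
    using pq(2) by simp
qed

text \<open>From \<epsilon> = 1 the left child keeps the sign exactly when
  \<open>(c + d)\<^sup>2 > N\<close>. Positivity of the label excludes
  \<open>c + d \<le> - sqrt N\<close>, so this says \<open>c + d > sqrt N\<close>, that is
  \<open>(sqrt N - c) / d < 1\<close>.\<close>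

lemma lpp_s_eq_Lt_iff: "lpp_s N p q n = Lt \<longleftrightarrow> lpp_z N p q n < 1"
proof -
  obtain c d where t: "cw_triple N p q (lpp N p q n) = (1, c, d)"
    using fst_cw_triple_lpp[of N p q n] by (cases "cw_triple N p q (lpp N p q n)") auto
  have d: "d > 0"
    using cw_triple_invariant[OF N pq(2,3) t] by auto
  have x: "lpp_x N p q n = (sqrt N + c) / d"
    using cw_label_eq_triple[OF N pq(2,3) t] by (simp add: lpp_x_def)
  then have z: "lpp_z N p q n = (sqrt N - c) / d"
    using qconj_triple[OF N, of 1 c d] by (simp add: lpp_z_def diff_divide_distrib)
  have "(sqrt N + c) / d > 0"
    using cw_label_pos[OF root_pos, of "lpp N p q n"] x by (simp only: lpp_x_def)
  then have lower: "- sqrt N < real_of_int (c + d)"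
    using d by (simp add: zero_less_divide_iff)
  have "lpp_s N p q n = Lt \<longleftrightarrow> \<not> N > (c + d)\<^sup>2"
    by (simp add: lpp_s_def lpp_next_def t)
  \<comment> \<open>Equality would make \<open>N\<close> a square.\<close>
  also have "\<dots> \<longleftrightarrow> N < (c + d)\<^sup>2"
    using N(2) by (metis linorder_neqE not_less_iff_gr_or_eq)
  also have "\<dots> \<longleftrightarrow> real_of_int N < (real_of_int (c + d))\<^sup>2"
    by (simp only: of_int_less_iff flip: of_int_power)
  also have "\<dots> \<longleftrightarrow> sqrt N < \<bar>real_of_int (c + d)\<bar>"
    by (metis real_sqrt_abs real_sqrt_less_iff)
  also have "\<dots> \<longleftrightarrow> sqrt N < real_of_int (c + d)"
    using lower by linarith
  also have "\<dots> \<longleftrightarrow> lpp_z N p q n < 1"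
    using d by (simp add: z field_simps)
  finally show ?thesis .
qed

lemma lpp_z_Suc:
  "lpp_z N p q (Suc n) =
    (if lpp_z N p q n < 1 then lpp_z N p q n / (1 - lpp_z N p q n) else lpp_z N p q n - 1)"
proof -
  have "lpp_z N p q (Suc n) = - (let y = - lpp_z N p q n
      in case lpp_s N p q n of Lt \<Rightarrow> y / (y + 1) | Rt \<Rightarrow> y + 1)"
    using qconj_cw_label_Cons[OF N pq(2,3), of "lpp_s N p q n" "lpp N p q n"]
    by (simp add: lpp_z_def lpp_x_def lpp_s_def del: cw_label.simps)
  then show ?thesis
    using lpp_s_eq_Lt_iff[of n] by (cases "lpp_s N p q n") (auto simp: Let_def)
qed

lemma lpp_z_0: "lpp_z N p q 0 = (sqrt N - p) / q"
  using qconj_triple[OF N, of 1 p q] by (simp add: lpp_z_def lpp_x_def diff_divide_distrib)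

lemma lpp_z_irrational: "lpp_z N p q n \<notin> \<rat>"
proof (induction n)
  case 0
  have "sqrt N = (sqrt N - p) / q * q + p"
    using pq(2) by simp
  then show ?case
    using sqrt_nonsquare_irrational[OF N] unfolding lpp_z_0
    by (metis Rats_add Rats_mult Rats_of_int)
next
  case (Suc n)
  let ?z = "lpp_z N p q n" and ?z' = "lpp_z N p q (Suc n)"
  \<comment> \<open>Inverting the step rationally: a rational successor would force a rational
    predecessor.\<close>
  have "?z = (if ?z < 1 then ?z' / (1 + ?z') else ?z' + 1)"
    unfolding lpp_z_Suc by (auto simp: field_simps)
  then show ?case
    using Suc.IH by (metis Rats_1 Rats_add Rats_divide)
qed

end

section \<open>Runs of repeated subtraction\<close>

text \<open>Stated for abstract \<open>w\<close> and \<open>D\<close> so that it serves both for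
  right runs, with \<open>w = z\<close>, and for left runs, with \<open>w = 1 / z\<close>. Starting
  from \<open>w m\<close>, exactly \<open>\<lfloor>w m\<rfloor>\<close> subtractions of 1 are made
  before the value drops below 1 and the direction changes.\<close>

lemma subtractive_run:
  fixes w :: "nat \<Rightarrow> real" and s :: "nat \<Rightarrow> 'a"
  assumes s: "\<And>k. s k = D \<longleftrightarrow> w k > 1"
    and step: "\<And>k. w k > 1 \<Longrightarrow> w (Suc k) = w k - 1"
    and m: "w m > 1" "w m \<notin> \<int>"
  shows "(LEAST k. k > m \<and> s (k - 1) \<noteq> s k) = m + nat \<lfloor>w m\<rfloor>"
    and "w (m + nat \<lfloor>w m\<rfloor>) = w m - \<lfloor>w m\<rfloor>"
proof -
  define a where "a = nat \<lfloor>w m\<rfloor>"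
  have a: "real a = \<lfloor>w m\<rfloor>" "a > 0"
    using m(1) by (auto simp: a_def)
  \<comment> \<open>Non-integrality gives \<open>w m > a\<close> strictly; this is what makes the
    last case \<open>j = a - 1\<close> work.\<close>
  have gt: "w m - real j > 1" if "j < a" for j
  proof -
    have "w m \<noteq> real a"
      using m(2) by auto
    then have "w m > real a"
      using a(1) by linarith
    moreover have "real j + 1 \<le> real a"
      using that by linarith
    ultimately show ?thesis by linarith
  qed
  have w: "w (m + j) = w m - real j" if "j \<le> a" for j
    using that
  proof (induction j)
    case (Suc j)
    then show ?case
      using step[of "m + j"] gt[of j] by simp
  qed simp
  show "w (m + nat \<lfloor>w m\<rfloor>) = w m - \<lfloor>w m\<rfloor>"
    using w[of a] a(1) by (simp add: a_def)
  have D: "s (m + j) = D" if "j < a" for j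
    using that s w[of j] gt[of j] by simp
  have nD: "s (m + a) \<noteq> D"
  proof -
    have "w (m + a) < 1"
      using w[of a] a(1) by linarith
    then show ?thesis using s by simp
  qed
  have "(LEAST k. k > m \<and> s (k - 1) \<noteq> s k) = m + a"
  proof (rule Least_equality)
    \<comment> \<open>Since \<open>a > 0\<close>, the index \<open>m + a - 1\<close> still belongs
      to the run.\<close>
    show "m + a > m \<and> s (m + a - 1) \<noteq> s (m + a)"
      using D[of "a - 1"] nD a(2) by simp
  next
    fix k
    assume k: "k > m \<and> s (k - 1) \<noteq> s k"
    show "m + a \<le> k"
    proof (rule ccontr)
      assume "\<not> m + a \<le> k"
      then have "s k = D" "s (k - 1) = D"
        using D[of "k - m"] D[of "k - 1 - m"] k by auto
      then show False
        using k by simp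
    qed
  qed
  then show "(LEAST k. k > m \<and> s (k - 1) \<noteq> s k) = m + nat \<lfloor>w m\<rfloor>"
    by (simp add: a_def)
qed

lemma cf_quot_irrational: "\<alpha> \<notin> \<rat> \<Longrightarrow> cf_quot \<alpha> n \<notin> \<rat>"
proof (induction n)
  case (Suc n)
  have "cf_quot \<alpha> n = 1 / cf_quot \<alpha> (Suc n) + \<lfloor>cf_quot \<alpha> n\<rfloor>"
    by simp
  then show ?case
    using Suc by (metis Rats_1 Rats_add Rats_divide Rats_of_int)
qed simp

lemma cf_quot_Suc_gt_1:
  assumes "\<alpha> \<notin> \<rat>"
  shows "cf_quot \<alpha> (Suc n) > 1"
proof -
  have "cf_quot \<alpha> n \<noteq> \<lfloor>cf_quot \<alpha> n\<rfloor>"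
    using cf_quot_irrational[OF assms, of n] by (metis Rats_of_int)
  then have "0 < cf_quot \<alpha> n - \<lfloor>cf_quot \<alpha> n\<rfloor>" "cf_quot \<alpha> n - \<lfloor>cf_quot \<alpha> n\<rfloor> < 1"
    by linarith+
  then show ?thesis by simp
qed

theorem proposition6:
  fixes N q :: int and n :: nat
  assumes "N > 0" and "\<nexists>k::int. N = k\<^sup>2"
    and "q > 0" and "q dvd N" and "N > q\<^sup>2"
  shows "(even n \<longrightarrow> cf_quot (sqrt N / q) n = - qconj N (lpp_y N 0 q n)) \<and>
    (odd n \<longrightarrow> cf_quot (sqrt N / q) n = - (1 / qconj N (lpp_y N 0 q n))) \<and>
    cf_coeff (sqrt N / q) n = lpp_t N 0 q n"
proof -
  let ?\<alpha> = "sqrt N / q"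
  define z where "z = lpp_z N 0 q"
  define s where "s = lpp_s N 0 q"
  note N = assms(1,2)
  have p: "(0::int)\<^sup>2 < N" "q dvd N - 0\<^sup>2"
    using assms by simp_all
  note ctx = N p(1) assms(3) p(2)
  have z0: "z 0 = ?\<alpha>"
    using lpp_z_0[OF ctx] by (simp add: z_def)
  have z_irr: "z k \<notin> \<rat>" for k
    using lpp_z_irrational[OF ctx] by (simp add: z_def)
  then have z1: "z k \<noteq> 1" for k
    by (metis Rats_1)
  have z_Suc: "z (Suc k) = (if z k < 1 then z k / (1 - z k) else z k - 1)" for k
    using lpp_z_Suc[OF ctx] by (simp add: z_def)
  have sLt: "s k = Lt \<longleftrightarrow> z k < 1" for k
    using lpp_s_eq_Lt_iff[OF ctx] by (simp add: z_def s_def)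
  have sRt: "s k = Rt \<longleftrightarrow> z k > 1" for k
    using sLt[of k] z1[of k] by (cases "s k") auto
  have alpha_irr: "?\<alpha> \<notin> \<rat>"
    using z_irr[of 0] z0 by simp
  \<comment> \<open>\<open>N > q\<^sup>2\<close> puts the initial quotient above 1 like all later
    ones, so the first run is a nonempty run of right steps.\<close>
  have "sqrt (real_of_int (q\<^sup>2)) < sqrt N"
    using assms(5) by (intro real_sqrt_less_mono) (simp only: of_int_less_iff)
  then have "?\<alpha> > 1"
    using assms(3) by simp
  then have zeta_gt: "cf_quot ?\<alpha> k > 1" for k
    using cf_quot_Suc_gt_1[OF alpha_irr] by (cases k) (auto simp del: cf_quot.simps(2))
  have zeta_int: "cf_quot ?\<alpha> k \<notin> \<int>" for k
    using cf_quot_irrational[OF alpha_irr] Ints_subset_Rats by blast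
  have pos: "z k > 0" for k
  proof (induction k)
    case 0
    then show ?case using \<open>?\<alpha> > 1\<close> z0 by simp
  next
    case (Suc k)
    then show ?case using z_Suc[of k] z1[of k] by auto
  qed
  let ?\<phi> = "lpp_phi N 0 q"
  \<comment> \<open>One run from a known starting value yields both its length, needed for
    \<open>a\<^sub>n = t\<^sub>n\<close>, and the starting value of the next run. The value left
    over is the fractional part of the current quotient, hence the reciprocal of the next; this
    causes the alternation with parity.\<close>
  have run: "?\<phi> (Suc k) = ?\<phi> k + nat \<lfloor>cf_quot ?\<alpha> k\<rfloor> \<and>
      z (?\<phi> (Suc k)) = (if even k then 1 / cf_quot ?\<alpha> (Suc k) else cf_quot ?\<alpha> (Suc k))"
    if k: "z (?\<phi> k) = (if even k then cf_quot ?\<alpha> k else 1 / cf_quot ?\<alpha> k)" for k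
  proof (cases "even k")
    case True
    have zk: "z (?\<phi> k) = cf_quot ?\<alpha> k"
      using k True by simp
    have run: "(LEAST j. j > ?\<phi> k \<and> s (j - 1) \<noteq> s j) = ?\<phi> k + nat \<lfloor>z (?\<phi> k)\<rfloor>"
      "z (?\<phi> k + nat \<lfloor>z (?\<phi> k)\<rfloor>) = z (?\<phi> k) - \<lfloor>z (?\<phi> k)\<rfloor>"
      using sRt z_Suc zeta_gt[of k] zeta_int[of k] zk
      by (intro subtractive_run[where D = Rt and w = z]; simp)+
    show ?thesis
      using run True by (simp add: zk s_def)
  next
    case False
    \<comment> \<open>At odd indices the reciprocal carries the quotient: \<open>z / (1 - z)\<close>
      has reciprocal \<open>1 / z - 1\<close>, so left steps subtract 1 from
      \<open>?w\<close>.\<close>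
    let ?w = "\<lambda>j. 1 / z j"
    have zk: "?w (?\<phi> k) = cf_quot ?\<alpha> k"
      using k False by simp
    have sw: "s j = Lt \<longleftrightarrow> ?w j > 1" for j
      using sLt[of j] pos[of j] by simp
    have ww: "?w (Suc j) = ?w j - 1" if "?w j > 1" for j
    proof -
      have "z j < 1"
        using that pos[of j] by simp
      then show ?thesis
        using pos[of j] by (simp add: z_Suc field_simps)
    qed
    have run: "(LEAST j. j > ?\<phi> k \<and> s (j - 1) \<noteq> s j) = ?\<phi> k + nat \<lfloor>?w (?\<phi> k)\<rfloor>"
      "?w (?\<phi> k + nat \<lfloor>?w (?\<phi> k)\<rfloor>) = ?w (?\<phi> k) - \<lfloor>?w (?\<phi> k)\<rfloor>"
      using sw ww zeta_gt[of k] zeta_int[of k] zk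
      by (intro subtractive_run[where D = Lt and w = ?w]; simp)+
    have phi: "?\<phi> (Suc k) = ?\<phi> k + nat \<lfloor>cf_quot ?\<alpha> k\<rfloor>"
      using run(1) unfolding zk by (simp add: s_def)
    have "z (?\<phi> (Suc k)) = 1 / ?w (?\<phi> (Suc k))"
      by simp
    also have "\<dots> = cf_quot ?\<alpha> (Suc k)"
      using run(2) unfolding zk phi by simp
    finally show ?thesis
      using phi False by simp
  qed
  have inv: "z (?\<phi> k) = (if even k then cf_quot ?\<alpha> k else 1 / cf_quot ?\<alpha> k)" for k
  proof (induction k)
    case 0
    then show ?case by (simp add: z0)
  next
    case (Suc k)
    then show ?case using run[OF Suc.IH] by (metis even_Suc)
  qed
  have y: "z (?\<phi> n) = - qconj N (lpp_y N 0 q n)"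
    by (simp add: z_def lpp_z_def lpp_y_def)
  \<comment> \<open>The floor is positive because the quotient exceeds 1, so \<open>nat\<close> in
    the run length loses nothing.\<close>
  have "cf_coeff ?\<alpha> n = lpp_t N 0 q n"
    using run[OF inv, of n] zeta_gt[of n]
    by (simp add: cf_coeff_def lpp_t_def del: lpp_phi.simps)
  moreover have "cf_quot ?\<alpha> n = (if even n then z (?\<phi> n) else 1 / z (?\<phi> n))"
    by (simp add: inv)
  ultimately show ?thesis
    unfolding y by simp
qed

end
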